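(* Let $\mu$ be the Möbius function of $\mathcal{P}$. For every path $P \in \mathcal{P}$ and every integer $k\ge 0$ we have $$ \mu^k(P, \mathbf{1}_{|P|}) = \begin{cases} 0, & \text{if } k < \delta(P);\\ (-1)^{l(P,\mathbf{1}_{|P|})} f(P), & \text{if } k = \delta(P). \end{cases} $$
   Context: A (binary) path of length $n$ is a lattice path $P=p_1\cdots p_n$ starting at the origin, each step being an upstep $u=(1,1)$ or a downstep $d=(1,-1)$; $|P|=n$ is its length, $\mathcal{P}_n$ the set of paths of length $n$, $\mathcal{P}=\bigcup_{n\ge0}\mathcal{P}_n$, and $[k]=\{1,\dots,k\}$. $\mathcal{P}_n$ is ordered by $P\le Q$ iff $P$ lies weakly below $Q$ (at each abscissa the height, i.e. $y$-coordinate, of $P$ is at most that of $Q$); its maximum is $\mathbf{1}_n=u^n$. Paths of different lengths are incomparable in $\mathcal P$. For $P\le Q$ in $\mathcal{P}_n$, $l(P,Q)$ is the length of every maximal chain of the interval $[P,Q]$ ($\mathcal P_n$ is a graded lattice). A valley of $P$ is the last point of a maximal run of $d$'s: it is either the middle point of an occurrence of $du$, or the endpoint of $P$ when $P$ ends with $d$. Turning a valley into a peak means replacing the corresponding $du$ by $ud$ (or, for a valley at the end of the path, the final $d$ by $u$). The filling of $P$ is the path $\widetilde P$ obtained by turning every valley of $P$ into a peak (so $\widetilde{\mathbf 1_n}=\mathbf 1_n$). Put $P^{(0)}=P$, $P^{(i)}=\widetilde{P^{(i-1)}}$; the degree $\delta(P)$ is the least $k\ge0$ with $P^{(k)}=\mathbf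 1_{|P|}$. A chain $P_0\le P_1\le\cdots\le P_k$ (of length $k$) has small intervals if for each $i\in[k]$ the path $P_i$ is obtained from $P_{i-1}$ by turning some valleys of $P_{i-1}$ into peaks (equivalently $P_{i-1}\le P_i\le\widetilde{P_{i-1}}$). $f(P)$ is the number of chains of length $\delta(P)$ with small intervals from $P$ to $\mathbf 1_{|P|}$. $\mu^k$ denotes the $k$-th power of $\mu$ under convolution in the incidence algebra, $(\alpha\beta)(x,y)=\sum_{x\le z\le y}\alpha(x,z)\beta(z,y)$, with $\mu^0$ the identity of the incidence algebra. *)

theory Defs
  imports Main
begin

class locally_finite_order = order +
  assumes finite_interval: "finite {z. a \<le> z \<and> z \<le> b}"

lemma finite_atLeastAtMost_locally_finite [simp]:
  "finite {a..b :: 'a :: locally_finite_order}"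
  using finite_interval[of a b] by (simp add: atLeastAtMost_def atLeast_def atMost_def Collect_conj_eq)

definition convolution ::
    "('a :: locally_finite_order \<Rightarrow> 'a \<Rightarrow> int) \<Rightarrow> ('a \<Rightarrow> 'a \<Rightarrow> int) \<Rightarrow> 'a \<Rightarrow> 'a \<Rightarrow> int" where
  "convolution \<alpha> \<beta> x y = (\<Sum>z\<in>{x..y}. \<alpha> x z * \<beta> z y)"

definition incidence_one :: "'a :: locally_finite_order \<Rightarrow> 'a \<Rightarrow> int" where
  "incidence_one x y = (if x = y then 1 else 0)"

definition incidence_zeta :: "'a :: locally_finite_order \<Rightarrow> 'a \<Rightarrow> int" where
  "incidence_zeta x y = (if x \<le> y then 1 else 0)"

primrec convolution_power ::
    "('a :: locally_finite_order \<Rightarrow> 'a \<Rightarrow> int) \<Rightarrow> nat \<Rightarrow> 'a \<Rightarrow> 'a \<Rightarrow> int" where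
  "convolution_power \<alpha> 0 = incidence_one"
| "convolution_power \<alpha> (Suc k) = convolution \<alpha> (convolution_power \<alpha> k)"

function moebius :: "'a :: locally_finite_order \<Rightarrow> 'a \<Rightarrow> int" where
  "moebius x y =
     (if x = y then 1 else if x < y then - (\<Sum>z\<in>{x..<y}. moebius x z) else 0)"
  by pat_completeness auto
termination
proof (relation "measure (\<lambda>(x, y). card {x..y})")
  fix x y z :: 'a
  assume "x \<noteq> y" "x < y" "z \<in> {x..<y}"
  then have "{x..z} \<subseteq> {x..y}" "y \<in> {x..y}" "y \<notin> {x..z}"
    by auto
  then have "{x..z} \<subset> {x..y}"
    by blast
  then show "((x, z), (x, y)) \<in> measure (\<lambda>(x, y). card {x..y})"
    by (simp add: psubset_card_mono)
qed simp

declare moebius.simps [simp del]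

lemma convolution_moebius_zeta: "convolution moebius incidence_zeta = incidence_one"
proof (intro ext)
  fix x y :: 'a
  have *: "convolution moebius incidence_zeta x y = (\<Sum>z\<in>{x..y}. moebius x z)"
    unfolding convolution_def incidence_zeta_def by (intro sum.cong) auto
  consider "x = y" | "x < y" | "\<not> x \<le> y"
    by (auto simp: less_le)
  then show "convolution moebius incidence_zeta x y = incidence_one x y"
  proof cases
    case 1
    then show ?thesis
      using * by (simp add: incidence_one_def moebius.simps[of y y])
  next
    case 2
    then have "{x..y} = insert y {x..<y}"
      by auto
    moreover have "finite {x..<y}"
      by (rule finite_subset[of _ "{x..y}"]) auto
    ultimately have "(\<Sum>z\<in>{x..y}. moebius x z) = moebius x y + (\<Sum>z\<in>{x..<y}. moebius x z)"
      by simp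
    with 2 show ?thesis
      by (simp add: * incidence_one_def moebius.simps[of x y])
  next
    case 3
    then show ?thesis
      by (auto simp: * incidence_one_def)
  qed
qed

text \<open>The length of a chain with \<open>m\<close> elements is \<open>m - 1\<close>. The value is only meaningful when all
  maximal chains of the interval have the same length.\<close>

definition interval_length :: "'a :: locally_finite_order \<Rightarrow> 'a \<Rightarrow> nat" where
  "interval_length x y = (THE m. \<forall>C. pred_on.maxchain {x..y} (<) C \<longrightarrow> card C - 1 = m)"

datatype step = Up | Down

datatype binpath = Path (steps: "step list")

definition path_length :: "binpath \<Rightarrow> nat" where
  "path_length P = length (steps P)"

primrec step_rise :: "step \<Rightarrow> int" where
  "step_rise Up = 1"
| "step_rise Down = -1"

definition height_at :: "binpath \<Rightarrow> nat \<Rightarrow> int" where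
  "height_at P i = (\<Sum>s\<leftarrow>take i (steps P). step_rise s)"

lemma steps_eqI_height:
  assumes "length xs = length ys"
    and "\<And>i. i \<le> length xs \<Longrightarrow>
      (\<Sum>s\<leftarrow>take i xs. step_rise s) = (\<Sum>s\<leftarrow>take i ys. step_rise s)"
  shows "xs = ys"
proof (rule nth_equalityI)
  fix i assume i: "i < length xs"
  have "step_rise (xs ! i) = step_rise (ys ! i)"
    using assms(2)[of i] assms(2)[of "Suc i"] i assms(1) by (simp add: take_Suc_conv_app_nth)
  then show "xs ! i = ys ! i"
    by (cases "xs ! i"; cases "ys ! i") auto
qed (fact assms(1))

instantiation binpath :: order
begin

definition less_eq_binpath :: "binpath \<Rightarrow> binpath \<Rightarrow> bool" where
  "P \<le> Q \<longleftrightarrow> path_length P = path_length Q \<and> (\<forall>i\<le>path_length P. height_at P i \<le> height_at Q i)"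

definition less_binpath :: "binpath \<Rightarrow> binpath \<Rightarrow> bool" where
  "P < Q \<longleftrightarrow> P \<le> Q \<and> \<not> Q \<le> (P :: binpath)"

instance
proof
  fix P Q R :: binpath
  show "P < Q \<longleftrightarrow> P \<le> Q \<and> \<not> Q \<le> P"
    by (rule less_binpath_def)
  show "P \<le> P"
    by (simp add: less_eq_binpath_def)
  show "P \<le> Q \<Longrightarrow> Q \<le> R \<Longrightarrow> P \<le> R"
    by (force simp: less_eq_binpath_def)
  assume "P \<le> Q" "Q \<le> P"
  then have "steps P = steps Q"
    by (intro steps_eqI_height)
      (auto simp: less_eq_binpath_def path_length_def height_at_def intro: antisym)
  then show "P = Q"
    by (simp add: binpath.expand)
qed

end

instance binpath :: locally_finite_order
proof
  fix P Q :: binpath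
  have "(UNIV :: step set) = {Up, Down}"
    using step.exhaust by auto
  then have "finite (UNIV :: step set)"
    by (metis finite.emptyI finite.insertI)
  from finite_lists_length_eq[OF this, of "path_length P"]
  have "finite (Path ` {xs. length xs = path_length P})"
    by simp
  moreover have "{R. P \<le> R \<and> R \<le> Q} \<subseteq> Path ` {xs. length xs = path_length P}"
  proof
    fix R assume "R \<in> {R. P \<le> R \<and> R \<le> Q}"
    then show "R \<in> Path ` {xs. length xs = path_length P}"
      by (cases R) (auto simp: less_eq_binpath_def path_length_def)
  qed
  ultimately show "finite {R. P \<le> R \<and> R \<le> Q}"
    by (rule finite_subset[rotated])
qed

definition top_path :: "nat \<Rightarrow> binpath" where
  "top_path n = Path (replicate n Up)"

text \<open>Valleys are given by their abscissae: the valley at abscissa \<open>i\<close> lies between the steps with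
  (0-based) list indices \<open>i - 1\<close> and \<open>i\<close>.\<close>

definition valleys :: "binpath \<Rightarrow> nat set" where
  "valleys P = {i. 0 < i \<and> i \<le> path_length P \<and> steps P ! (i - 1) = Down \<and>
                   (i < path_length P \<longrightarrow> steps P ! i = Up)}"

text \<open>Intended for sets \<open>S\<close> of valleys of \<open>P\<close>: the step ending at a valley in \<open>S\<close> becomes \<open>Up\<close> and the
  step starting there, if any, becomes \<open>Down\<close>. No two valleys are adjacent, so the cases do not
  interfere.\<close>

definition turn_valleys :: "nat set \<Rightarrow> binpath \<Rightarrow> binpath" where
  "turn_valleys S P =
     Path (map (\<lambda>j. if Suc j \<in> S then Up else if j \<in> S then Down else steps P ! j)
               [0..<path_length P])"

definition filling :: "binpath \<Rightarrow> binpath" where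
  "filling P = turn_valleys (valleys P) P"

definition path_degree :: "binpath \<Rightarrow> nat" where
  "path_degree P = (LEAST k. (filling ^^ k) P = top_path (path_length P))"

text \<open>The chain \<open>P\<^sub>0 \<le> \<dots> \<le> P\<^sub>k\<close> of length \<open>k\<close> is the list of its \<open>k + 1\<close> members. The chain is weakly
  increasing and the set of valleys turned at each step may be empty.\<close>

definition small_interval_chain :: "binpath list \<Rightarrow> bool" where
  "small_interval_chain C \<longleftrightarrow>
     C \<noteq> [] \<and> sorted_wrt (\<le>) C \<and>
     (\<forall>i\<in>{1..<length C}. \<exists>S\<subseteq>valleys (C ! (i - 1)). C ! i = turn_valleys S (C ! (i - 1)))"

definition num_small_chains :: "binpath \<Rightarrow> nat" where
  "num_small_chains P =
     card {C. small_interval_chain C \<and> length C = path_degree P + 1 \<and>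
              hd C = P \<and> last C = top_path (path_length P)}"

end

theory Submission
  imports Defs
begin

text \<open>For \<open>S\<close> a set of valleys of \<open>P\<close>, turning the valleys in \<open>S\<close> gives a path below \<open>Q \<ge> P\<close> iff
  \<open>P\<close> is strictly below \<open>Q\<close> at every valley in \<open>S\<close>. By inclusion-exclusion, \<open>\<mu>(P, Q)\<close> is therefore
  \<open>(-1)^|S|\<close> if \<open>Q\<close> arises from \<open>P\<close> by turning \<open>S\<close>, and \<open>0\<close> if \<open>[P, Q]\<close> is not a small interval. Since
  \<open>|S|\<close> is the rank difference, all terms of the \<open>k\<close>-th power of \<open>\<mu>\<close> at \<open>(P, 1)\<close> carry the same sign,
  and up to this sign it counts the chains of length \<open>k\<close> with small intervals. As filling is monotone,
  the \<open>i\<close>-th member of such a chain lies below the \<open>i\<close>-fold filling of \<open>P\<close>, so no chain reaches the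
  top in fewer than \<open>\<delta>(P)\<close> steps.\<close>

section \<open>Moebius functions and graded intervals\<close>

text \<open>For fixed \<open>x\<close> the recursion of \<open>moebius\<close> determines every
  value from the sums over the intervals \<open>{x..z}\<close>. An explicit candidate thus only has
  to have the right sums.\<close>

lemma moebius_eqI:
  fixes m :: "'a :: locally_finite_order \<Rightarrow> int"
  assumes sums: "\<And>z. x \<le> z \<Longrightarrow> (\<Sum>w\<in>{x..z}. m w) = (if x = z then 1 else 0)"
    and "x \<le> y"
  shows "moebius x y = m y"
  using \<open>x \<le> y\<close>
proof (induction "card {x..y}" arbitrary: y rule: less_induct)
  case less
  show ?case
  proof (cases "x = y")
    case True
    then show ?thesis
      using sums[of x] by (simp add: moebius.simps[of y y])
  next
    case False
    with less.prems have "x < y"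
      by simp
    have "moebius x z = m z" if "z \<in> {x..<y}" for z
    proof (rule less.hyps)
      have "y \<in> {x..y}" "y \<notin> {x..z}" "{x..z} \<subseteq> {x..y}"
        using that less.prems by auto
      then have "{x..z} \<subset> {x..y}"
        by blast
      then show "card {x..z} < card {x..y}"
        by (simp add: psubset_card_mono)
    qed (use that in auto)
    then have "moebius x y = - (\<Sum>z\<in>{x..<y}. m z)"
      using \<open>x < y\<close> by (simp add: moebius.simps[of x y])
    moreover have "{x..y} = insert y {x..<y}"
      using less.prems by auto
    moreover have "finite {x..<y}"
      by (rule finite_subset[of _ "{x..y}"]) auto
    ultimately show ?thesis
      using sums[OF less.prems] \<open>x \<noteq> y\<close> by simp
  qed
qed

text \<open>Expanding the product of the factors (-1) + 1 over \<open>A\<close> yields one term per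
  subset, and the product vanishes unless it is empty.\<close>

lemma sum_minus_one_power_card_Pow:
  assumes "finite A"
  shows "(\<Sum>S\<in>Pow A. (-1 :: 'a :: comm_ring_1) ^ card S) = (if A = {} then 1 else 0)"
proof -
  have "(\<Prod>a\<in>A. (-1) + (1 :: 'a)) = (\<Sum>S\<in>Pow A. (-1) ^ card S)"
    using assms by (subst prod_add) (auto simp: finite_subset)
  then show ?thesis
    using assms by (auto simp: power_0_left card_eq_0_iff)
qed

text \<open>On the chain \<rho> is injective, and its image has no gap: over a gap,
  \<open>step\<close> yields an element comparable with the whole chain, which maximality puts into
  the chain.\<close>

lemma card_maxchain_graded:
  fixes \<rho> :: "'a :: locally_finite_order \<Rightarrow> nat"
  assumes mono: "\<And>a b. a < b \<Longrightarrow> \<rho> a < \<rho> b"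
    and step: "\<And>a b. x \<le> a \<Longrightarrow> a < b \<Longrightarrow> b \<le> y \<Longrightarrow> \<exists>c. a < c \<and> c \<le> b \<and> \<rho> c = Suc (\<rho> a)"
    and "x \<le> y"
    and C: "pred_on.maxchain {x..y} (<) C"
  shows "card C - 1 = \<rho> y - \<rho> x"
proof -
  have sub: "C \<subseteq> {x..y}"
    using C unfolding pred_on.maxchain_def pred_on.chain_def by auto
  have cmp: "a < b \<or> a = b \<or> b < a" if "a \<in> C" "b \<in> C" for a b
    using C that unfolding pred_on.maxchain_def pred_on.chain_def by auto
  have max: "c \<in> C" if "c \<in> {x..y}" "\<And>b. b \<in> C \<Longrightarrow> c < b \<or> c = b \<or> b < c" for c
  proof (rule ccontr)
    assume "c \<notin> C"
    moreover have "pred_on.chain {x..y} (<) (insert c C)"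
      using C that unfolding pred_on.maxchain_def pred_on.chain_def by blast
    ultimately show False
      using C unfolding pred_on.maxchain_def by blast
  qed
  have fin: "finite C"
    by (rule finite_subset[OF sub]) simp
  have \<rho>_le: "\<rho> a \<le> \<rho> b" if "a \<le> b" for a b
    using mono[of a b] that by (auto simp: le_less)
  have "x \<in> C"
  proof (rule max)
    show "x < b \<or> x = b \<or> b < x" if "b \<in> C" for b
      using sub that by (auto simp: le_less)
  qed (use \<open>x \<le> y\<close> in simp)
  have "y \<in> C"
  proof (rule max)
    show "y < b \<or> y = b \<or> b < y" if "b \<in> C" for b
      using sub that by (auto simp: le_less)
  qed (use \<open>x \<le> y\<close> in simp)
  have inj: "inj_on \<rho> C"
  proof (rule inj_onI)
    fix a b assume "a \<in> C" "b \<in> C" "\<rho> a = \<rho> b"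
    then show "a = b"
      using cmp[of a b] mono[of a b] mono[of b a] by auto
  qed
  have "\<rho> ` C = {\<rho> x..\<rho> y}"
  proof
    show "\<rho> ` C \<subseteq> {\<rho> x..\<rho> y}"
      using sub \<rho>_le by auto
    show "{\<rho> x..\<rho> y} \<subseteq> \<rho> ` C"
    proof
      fix r assume r: "r \<in> {\<rho> x..\<rho> y}"
      \<comment> \<open>Among the members of \<open>C\<close> of rank at most \<open>r\<close>, take
        \<open>a\<close> of largest rank; below, \<open>b\<close> is the next member of
        \<open>C\<close> after \<open>a\<close>. If \<open>a\<close> misses rank \<open>r\<close>,
        the element \<open>c\<close> of rank one above \<open>a\<close> fits between
        \<open>a\<close> and \<open>b\<close>, contradicting the choice of \<open>a\<close>.\<close>
      define A where "A = {a \<in> C. \<rho> a \<le> r}"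
      have "finite A" "x \<in> A"
        using fin r \<open>x \<in> C\<close> by (auto simp: A_def)
      then have "Max (\<rho> ` A) \<in> \<rho> ` A"
        by (intro Max_in) auto
      then obtain a where "a \<in> A" "\<rho> a = Max (\<rho> ` A)"
        by force
      with \<open>finite A\<close> have a: "a \<in> A" "\<And>b. b \<in> A \<Longrightarrow> \<rho> b \<le> \<rho> a"
        by simp_all
      define B where "B = {b \<in> C. a < b}"
      show "r \<in> \<rho> ` C"
      proof (cases "\<rho> a = r")
        case True
        then show ?thesis
          using a by (auto simp: A_def)
      next
        case False
        then have "\<rho> a < r" "a \<in> C"
          using a by (auto simp: A_def)
        then have "a < y"
          using r \<open>y \<in> C\<close> sub \<rho>_le[of y a] cmp[of a y] by fastforce
        then have "finite B" "y \<in> B"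
          using fin \<open>y \<in> C\<close> by (auto simp: B_def)
        then have "Min (\<rho> ` B) \<in> \<rho> ` B"
          by (intro Min_in) auto
        then obtain b where "b \<in> B" "\<rho> b = Min (\<rho> ` B)"
          by force
        with \<open>finite B\<close> have b: "b \<in> B" "\<And>c. c \<in> B \<Longrightarrow> \<rho> b \<le> \<rho> c"
          by simp_all
        have "b \<in> C" "a < b"
          using b by (auto simp: B_def)
        then have "\<rho> a < \<rho> b" "x \<le> a" "b \<le> y"
          using mono sub \<open>a \<in> C\<close> by auto
        then obtain c where c: "a < c" "c \<le> b" "\<rho> c = Suc (\<rho> a)"
          using step \<open>a < b\<close> by blast
        have "c \<in> C"
        proof (rule max)
          show "c \<in> {x..y}"
            using c \<open>x \<le> a\<close> \<open>b \<le> y\<close> by auto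
          fix d assume d: "d \<in> C"
          show "c < d \<or> c = d \<or> d < c"
          proof (cases "a < d")
            case True
            then have "\<rho> b \<le> \<rho> d"
              using b d by (auto simp: B_def)
            then have "b \<le> d"
              using cmp[OF \<open>b \<in> C\<close> d] mono[of d b] by auto
            then show ?thesis
              using c by auto
          next
            case False
            then have "d \<le> a"
              using cmp[OF \<open>a \<in> C\<close> d] by auto
            then show ?thesis
              using c by auto
          qed
        qed
        moreover have "\<rho> c \<le> r"
          using c \<open>\<rho> a < r\<close> by simp
        ultimately have "\<rho> c \<le> \<rho> a"
          using a by (simp add: A_def)
        then show ?thesis
          using c by simp
      qed
    qed
  qed
  then have "card C = Suc (\<rho> y - \<rho> x)"
    using card_image[OF inj] \<rho>_le[OF \<open>x \<le> y\<close>] by simp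
  then show ?thesis
    by simp
qed

lemma interval_length_graded:
  fixes \<rho> :: "'a :: locally_finite_order \<Rightarrow> nat"
  assumes "\<And>a b. a < b \<Longrightarrow> \<rho> a < \<rho> b"
    and "\<And>a b. x \<le> a \<Longrightarrow> a < b \<Longrightarrow> b \<le> y \<Longrightarrow> \<exists>c. a < c \<and> c \<le> b \<and> \<rho> c = Suc (\<rho> a)"
    and "x \<le> y"
  shows "interval_length x y = \<rho> y - \<rho> x"
proof -
  \<comment> \<open>A maximal chain must exist for \<open>THE\<close> to be determined: otherwise
    every number would satisfy the condition vacuously.\<close>
  obtain C where C: "pred_on.maxchain {x..y} (<) C"
    using pred_on.Hausdorff by blast
  show ?thesis
    unfolding interval_length_def
    using C card_maxchain_graded[of \<rho>, OF assms] by (intro the_equality) auto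
qed

section \<open>Turning valleys\<close>

text \<open>Counts replace heights because turning a valley raises the count there by one, but the
  height by two.\<close>

definition ups :: "binpath \<Rightarrow> nat \<Rightarrow> nat" where
  "ups P i = count_list (take i (steps P)) Up"

lemma ups_0 [simp]: "ups P 0 = 0"
  by (simp add: ups_def)

lemma ups_Suc:
  "i < path_length P \<Longrightarrow> ups P (Suc i) = ups P i + (if steps P ! i = Up then 1 else 0)"
  by (simp add: ups_def path_length_def take_Suc_conv_app_nth)

lemma height_at_ups:
  assumes "i \<le> path_length P"
  shows "height_at P i = 2 * int (ups P i) - int i"
  using assms
proof (induction i)
  case 0
  then show ?case by (simp add: height_at_def)
next
  case (Suc i)
  then have "height_at P (Suc i) = height_at P i + step_rise (steps P ! i)"
    by (simp add: height_at_def path_length_def take_Suc_conv_app_nth)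
  with Suc show ?case
    by (cases "steps P ! i") (auto simp: ups_Suc)
qed

lemma less_eq_binpath_ups:
  "P \<le> Q \<longleftrightarrow> path_length P = path_length Q \<and> (\<forall>i\<le>path_length P. ups P i \<le> ups Q i)"
  by (auto simp: less_eq_binpath_def height_at_ups)

lemma path_length_turn_valleys [simp]: "path_length (turn_valleys S P) = path_length P"
  by (simp add: turn_valleys_def path_length_def)

lemma valleys_subset: "valleys P \<subseteq> {1..path_length P}"
  by (auto simp: valleys_def)

lemma finite_valleys [simp]: "finite (valleys P)"
  by (rule finite_subset[OF valleys_subset]) simp

lemma ups_turn_valleys:
  assumes "S \<subseteq> valleys P" "i \<le> path_length P"
  shows "ups (turn_valleys S P) i = ups P i + (if i \<in> S then 1 else 0)"
  using assms(2)
proof (induction i)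
  case 0
  then show ?case using assms(1) by (auto simp: valleys_def)
next
  case (Suc i)
  have "steps (turn_valleys S P) ! i =
      (if Suc i \<in> S then Up else if i \<in> S then Down else steps P ! i)"
    using Suc.prems by (simp add: turn_valleys_def path_length_def)
  \<comment> \<open>Membership of \<open>Suc i\<close> in \<open>S\<close> makes step
    \<open>i\<close> of \<open>P\<close> a downstep, membership of \<open>i\<close> makes it an
    upstep, so at most one of them applies.\<close>
  moreover have "Suc i \<in> S \<Longrightarrow> Suc i \<in> valleys P" "i \<in> S \<Longrightarrow> i \<in> valleys P"
    using assms(1) by auto
  then have "Suc i \<in> S \<Longrightarrow> steps P ! i = Down" "i \<in> S \<Longrightarrow> steps P ! i = Up"
    using Suc.prems by (auto simp: valleys_def)
  ultimately show ?case
    using Suc by (auto simp: ups_Suc split: if_splits)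
qed

lemma le_turn_valleys: "S \<subseteq> valleys P \<Longrightarrow> P \<le> turn_valleys S P"
  by (simp add: less_eq_binpath_ups ups_turn_valleys)

text \<open>The set \<open>S\<close> can be recovered as the abscissae at which \<open>ups\<close>
  increases.\<close>

lemma inj_on_turn_valleys: "inj_on (\<lambda>S. turn_valleys S P) (Pow (valleys P))"
proof (rule inj_onI)
  fix S T
  assume S: "S \<in> Pow (valleys P)" and T: "T \<in> Pow (valleys P)"
    and eq: "turn_valleys S P = turn_valleys T P"
  have "i \<in> S \<longleftrightarrow> i \<in> T" if "i \<le> path_length P" for i
    using ups_turn_valleys[of S P i] ups_turn_valleys[of T P i] S T eq that by (auto split: if_splits)
  then show "S = T"
    using S T valleys_subset[of P] by (auto simp: subset_iff)
qed

text \<open>At a lowest point of \<open>P\<close> among those strictly below \<open>Q\<close>, \<open>P\<close> can neither arrive by an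
  upstep nor leave by a downstep, as the adjacent point would be lower still and strictly below \<open>Q\<close>.\<close>

lemma ex_valley_below:
  assumes "P < Q"
  obtains v where "v \<in> valleys P" "ups P v < ups Q v"
proof -
  define n where "n = path_length P"
  have len: "path_length Q = n" and le: "\<And>i. i \<le> n \<Longrightarrow> ups P i \<le> ups Q i"
    using assms by (auto simp: n_def less_le less_eq_binpath_ups)
  define D where "D = {i. i \<le> n \<and> ups P i < ups Q i}"
  have "\<not> Q \<le> P"
    using assms by (simp add: less_le_not_le)
  then obtain i where "i \<le> n" "ups P i < ups Q i"
    using len by (auto simp: n_def less_eq_binpath_ups not_le)
  then have "D \<noteq> {}"
    by (auto simp: D_def)
  moreover have "finite D"
    by (simp add: D_def)
  ultimately have "Min (height_at P ` D) \<in> height_at P ` D"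
    by simp
  then obtain v where v: "v \<in> D" "height_at P v = Min (height_at P ` D)"
    by auto
  with \<open>finite D\<close> have "height_at P v \<le> height_at P i" if "i \<in> D" for i
    using that by simp
  then have min: "2 * int (ups P v) - int v \<le> 2 * int (ups P i) - int i" if "i \<in> D" for i
    using that v by (auto simp: D_def n_def height_at_ups)
  have vn: "v \<le> n" and below: "ups P v < ups Q v"
    using v by (auto simp: D_def)
  from below obtain w where w: "v = Suc w"
    by (cases v) auto
  have "steps P ! w = Down"
  proof (rule ccontr)
    assume "steps P ! w \<noteq> Down"
    then have "steps P ! w = Up"
      by (cases "steps P ! w") auto
    \<comment> \<open>\<open>P\<close> gains one upstep from \<open>w\<close> to \<open>v\<close>
      and \<open>Q\<close> at most one, so the strict inequality already holds at \<open>w\<close>,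
      where \<open>P\<close> is lower.\<close>
    then have "w \<in> D" "ups P v = Suc (ups P w)"
      using below vn len by (auto simp: D_def w ups_Suc n_def split: if_splits)
    then show False
      using min[of w] w by simp
  qed
  moreover have "steps P ! v = Up" if "v < n"
  proof (rule ccontr)
    assume "steps P ! v \<noteq> Up"
    then have "Suc v \<in> D" "ups P (Suc v) = ups P v"
      using below that len by (auto simp: D_def ups_Suc n_def split: if_splits)
    then show False
      using min[of "Suc v"] by simp
  qed
  ultimately have "v \<in> valleys P"
    using vn w by (simp add: valleys_def n_def)
  then show ?thesis
    using below that by blast
qed

lemma turn_valleys_le_iff:
  assumes "S \<subseteq> valleys P" "P \<le> Q"
  shows "turn_valleys S P \<le> Q \<longleftrightarrow> S \<subseteq> {v \<in> valleys P. ups P v < ups Q v}"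
  using assms valleys_subset[of P]
  by (fastforce simp: less_eq_binpath_ups ups_turn_valleys Suc_le_eq subset_iff)

text \<open>Up to a constant depending only on the length, this is half the sum of the heights. It
  serves as the rank function of the graded poset.\<close>

definition path_rank :: "binpath \<Rightarrow> nat" where
  "path_rank P = (\<Sum>i\<le>path_length P. ups P i)"

lemma path_rank_turn_valleys:
  assumes "S \<subseteq> valleys P"
  shows "path_rank (turn_valleys S P) = path_rank P + card S"
proof -
  have "{i. i \<le> path_length P \<and> i \<in> S} = S"
    using assms valleys_subset[of P] by auto
  then show ?thesis
    using assms by (simp add: path_rank_def ups_turn_valleys sum.distrib sum.If_cases Int_def)
qed

lemma path_rank_strict_mono:
  assumes "P < Q"
  shows "path_rank P < path_rank Q"
proof -
  obtain v where "v \<in> valleys P" "ups P v < ups Q v"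
    using ex_valley_below[OF assms] .
  then have "\<exists>i\<in>{..path_length P}. ups P i < ups Q i"
    using valleys_subset[of P] by (auto intro!: bexI[of _ v])
  moreover have "path_length Q = path_length P" "\<And>i. i \<le> path_length P \<Longrightarrow> ups P i \<le> ups Q i"
    using assms by (auto simp: less_le less_eq_binpath_ups)
  ultimately show ?thesis
    unfolding path_rank_def by (auto intro!: sum_strict_mono_ex1)
qed

lemma path_rank_mono: "P \<le> Q \<Longrightarrow> path_rank P \<le> path_rank Q"
  by (auto simp: le_less path_rank_strict_mono)

text \<open>If \<open>A < B\<close>, a valley of \<open>A\<close> strictly below \<open>B\<close>
  can be turned without leaving the interval, and this raises the rank by exactly one.\<close>

lemma interval_length_binpath:
  assumes "P \<le> Q"
  shows "interval_length P Q = path_rank Q - path_rank P"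
proof (rule interval_length_graded[OF path_rank_strict_mono _ assms])
  fix A B :: binpath assume "A < B"
  then obtain v where v: "v \<in> valleys A" "ups A v < ups B v"
    using ex_valley_below by blast
  have "path_rank (turn_valleys {v} A) = Suc (path_rank A)"
    using v by (simp add: path_rank_turn_valleys)
  moreover have "A \<le> turn_valleys {v} A" "turn_valleys {v} A \<le> B"
    using v \<open>A < B\<close> by (simp_all add: le_turn_valleys turn_valleys_le_iff)
  ultimately show "\<exists>C. A < C \<and> C \<le> B \<and> path_rank C = Suc (path_rank A)"
    by (metis n_not_Suc_n order_le_imp_less_or_eq)
qed

lemma moebius_binpath:
  assumes "P \<le> Q"
  shows "moebius P Q = (if Q \<in> (\<lambda>S. turn_valleys S P) ` Pow (valleys P)
    then (-1) ^ (path_rank Q - path_rank P) else 0)"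
proof (rule moebius_eqI[OF _ assms])
  fix R assume R: "P \<le> R"
  define T where "T = {v \<in> valleys P. ups P v < ups R v}"
  have T: "T \<subseteq> valleys P" "finite T"
    by (auto simp: T_def)
  \<comment> \<open>The fillings of \<open>P\<close> that stay below \<open>R\<close> are indexed by
    the subsets of \<open>T\<close>, so the sum over the interval becomes an alternating sum over
    \<open>Pow T\<close>.\<close>
  have "{P..R} \<inter> (\<lambda>S. turn_valleys S P) ` Pow (valleys P) = (\<lambda>S. turn_valleys S P) ` Pow T"
    using turn_valleys_le_iff[OF _ R, folded T_def] T(1) by (auto simp: le_turn_valleys)
  then have "(\<Sum>Q\<in>{P..R}. if Q \<in> (\<lambda>S. turn_valleys S P) ` Pow (valleys P)
      then (-1) ^ (path_rank Q - path_rank P) else 0) =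
      (\<Sum>Q\<in>(\<lambda>S. turn_valleys S P) ` Pow T. (-1 :: int) ^ (path_rank Q - path_rank P))"
    by (simp only: sum.inter_restrict[OF finite_atLeastAtMost_locally_finite, symmetric])
  also have "\<dots> = (\<Sum>S\<in>Pow T. (-1) ^ (path_rank (turn_valleys S P) - path_rank P))"
    using inj_on_subset[OF inj_on_turn_valleys, of "Pow T"] T by (subst sum.reindex) auto
  also have "\<dots> = (\<Sum>S\<in>Pow T. (-1) ^ card S)"
    using T by (intro sum.cong) (auto simp: path_rank_turn_valleys)
  also have "\<dots> = (if T = {} then 1 else 0)"
    by (rule sum_minus_one_power_card_Pow[OF T(2)])
  also have "T = {} \<longleftrightarrow> P = R"
  proof
    assume "T = {}"
    then show "P = R"
      using ex_valley_below[of P R] R by (auto simp: T_def le_less)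
  qed (simp add: T_def)
  finally show "(\<Sum>Q\<in>{P..R}. if Q \<in> (\<lambda>S. turn_valleys S P) ` Pow (valleys P)
      then (-1) ^ (path_rank Q - path_rank P) else 0) = (if P = R then 1 else 0 :: int)" .
qed

section \<open>Powers of the Moebius function and chains with small intervals\<close>

lemma le_top_path: "P \<le> top_path (path_length P)"
proof -
  have "count_list (replicate m Up) Up = m" for m
    by (induction m) simp_all
  then have "ups P i \<le> ups (top_path (path_length P)) i" if "i \<le> path_length P" for i
    using that count_le_length[of "take i (steps P)" Up]
    by (simp add: ups_def top_path_def path_length_def)
  then show ?thesis
    by (simp add: less_eq_binpath_ups) (simp add: top_path_def path_length_def)
qed

text \<open>The set counted by \<open>num_small_chains\<close>, with the length \<open>k\<close>
  left free so that induction on \<open>k\<close> is possible.\<close>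

definition small_chains :: "nat \<Rightarrow> binpath \<Rightarrow> binpath list set" where
  "small_chains k P = {C. small_interval_chain C \<and> length C = k + 1 \<and>
     hd C = P \<and> last C = top_path (path_length P)}"

lemma small_interval_chain_singleton [simp]: "small_interval_chain [P]"
  by (simp add: small_interval_chain_def)

lemma small_interval_chain_Cons:
  assumes "C \<noteq> []"
  shows "small_interval_chain (P # C) \<longleftrightarrow>
    (\<exists>S\<subseteq>valleys P. hd C = turn_valleys S P) \<and> small_interval_chain C"
proof -
  have "(\<forall>i\<in>{1..<length (P # C)}. \<exists>S\<subseteq>valleys ((P # C) ! (i - 1)).
        (P # C) ! i = turn_valleys S ((P # C) ! (i - 1))) \<longleftrightarrow>
      (\<exists>S\<subseteq>valleys P. hd C = turn_valleys S P) \<and>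
      (\<forall>i\<in>{1..<length C}. \<exists>S\<subseteq>valleys (C ! (i - 1)). C ! i = turn_valleys S (C ! (i - 1)))"
    (is "?L \<longleftrightarrow> ?R")
  proof -
    \<comment> \<open>Shifting the indices down by one lets index 0, the new first step of the
      chain, be split off.\<close>
    have "{1..<length (P # C)} = Suc ` {..<length C}"
      by (auto simp: image_Suc_lessThan)
    then have "?L \<longleftrightarrow>
        (\<forall>i\<in>{..<length C}. \<exists>S\<subseteq>valleys ((P # C) ! i). C ! i = turn_valleys S ((P # C) ! i))"
      by (simp only: ball_simps nth_Cons_Suc diff_Suc_1)
    also have "{..<length C} = insert 0 {1..<length C}"
      using assms by auto
    finally show ?thesis
      using assms by (simp add: hd_conv_nth nth_Cons' cong: ball_cong_simp)
  qed
  moreover have "sorted_wrt (\<le>) (P # C) \<longleftrightarrow> P \<le> hd C \<and> sorted_wrt (\<le>) C"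
    using assms by (cases C) (auto intro: order_trans)
  ultimately show ?thesis
    using assms le_turn_valleys unfolding small_interval_chain_def by auto
qed

lemma small_chains_0: "small_chains 0 P = (if P = top_path (path_length P) then {[P]} else {})"
  by (auto simp: small_chains_def length_Suc_conv)

lemma small_chains_Suc:
  "small_chains (Suc k) P = (\<Union>S\<in>Pow (valleys P). (#) P ` small_chains k (turn_valleys S P))"
proof (intro set_eqI iffI)
  fix C assume C: "C \<in> small_chains (Suc k) P"
  then obtain D where D: "C = P # D" "D \<noteq> []" "length D = k + 1"
    by (cases C; cases "tl C") (auto simp: small_chains_def)
  then show "C \<in> (\<Union>S\<in>Pow (valleys P). (#) P ` small_chains k (turn_valleys S P))"
    using C by (auto simp: small_chains_def small_interval_chain_Cons)
next
  fix C assume "C \<in> (\<Union>S\<in>Pow (valleys P). (#) P ` small_chains k (turn_valleys S P))"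
  then obtain S D where D: "C = P # D" "S \<subseteq> valleys P" "D \<in> small_chains k (turn_valleys S P)"
    by auto
  then have "D \<noteq> []"
    by (auto simp: small_chains_def)
  with D show "C \<in> small_chains (Suc k) P"
    by (auto simp: small_chains_def small_interval_chain_Cons)
qed

lemma finite_small_chains [simp]: "finite (small_chains k P)"
  by (induction k arbitrary: P) (simp_all add: small_chains_0 small_chains_Suc)

lemma card_small_chains_Suc:
  "card (small_chains (Suc k) P) = (\<Sum>S\<in>Pow (valleys P). card (small_chains k (turn_valleys S P)))"
proof -
  \<comment> \<open>Chains belonging to different sets of turned valleys differ in their second
    member.\<close>
  have "((#) P ` small_chains k (turn_valleys S P)) \<inter> ((#) P ` small_chains k (turn_valleys T P)) = {}"
    if "S \<in> Pow (valleys P)" "T \<in> Pow (valleys P)" "S \<noteq> T" for S T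
    using inj_onD[OF inj_on_turn_valleys[of P], of S T] that by (auto simp: small_chains_def)
  then show ?thesis
    unfolding small_chains_Suc by (subst card_UN_disjoint) (auto simp: card_image)
qed

text \<open>The sign of \<open>moebius\<close> at the first step and the sign from the induction
  hypothesis multiply to a sign independent of \<open>S\<close>. The remaining sum is the recursion
  for the number of chains.\<close>

lemma convolution_power_moebius_top:
  "convolution_power moebius k P (top_path (path_length P)) =
     (-1) ^ (path_rank (top_path (path_length P)) - path_rank P) * int (card (small_chains k P))"
proof (induction k arbitrary: P)
  case 0
  then show ?case
    by (auto simp: incidence_one_def small_chains_0)
next
  case (Suc k)
  let ?t = "top_path (path_length P)"
  let ?I = "(\<lambda>S. turn_valleys S P) ` Pow (valleys P)"
  let ?c = "\<lambda>Q. convolution_power moebius k Q ?t"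
  have sub: "?I \<subseteq> {P..?t}"
    using le_turn_valleys le_top_path[of "turn_valleys _ P"] by auto
  have "convolution_power moebius (Suc k) P ?t = (\<Sum>Q\<in>{P..?t}. moebius P Q * ?c Q)"
    by (simp add: convolution_def)
  also have "\<dots> = (\<Sum>Q\<in>?I. moebius P Q * ?c Q)"
    using sub by (intro sum.mono_neutral_right) (auto simp: moebius_binpath)
  also have "\<dots> = (\<Sum>S\<in>Pow (valleys P). moebius P (turn_valleys S P) * ?c (turn_valleys S P))"
    by (subst sum.reindex[OF inj_on_turn_valleys]) simp
  also have "\<dots> = (\<Sum>S\<in>Pow (valleys P). (-1) ^ (path_rank ?t - path_rank P) *
      int (card (small_chains k (turn_valleys S P))))"
  proof (rule sum.cong)
    fix S assume "S \<in> Pow (valleys P)"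
    then have S: "S \<subseteq> valleys P"
      by simp
    \<comment> \<open>This keeps the subtraction of natural numbers from being truncated, so that
      the exponents add up.\<close>
    have "path_rank (turn_valleys S P) \<le> path_rank ?t"
      using path_rank_mono[OF le_top_path[of "turn_valleys S P"]] by simp
    then have "path_rank ?t - path_rank P = card S + (path_rank ?t - path_rank (turn_valleys S P))"
      using S by (simp add: path_rank_turn_valleys)
    moreover have "moebius P (turn_valleys S P) = (-1) ^ card S"
      using S by (simp add: moebius_binpath le_turn_valleys path_rank_turn_valleys)
    ultimately show "moebius P (turn_valleys S P) * ?c (turn_valleys S P) =
        (-1) ^ (path_rank ?t - path_rank P) * int (card (small_chains k (turn_valleys S P)))"
      using Suc.IH[of "turn_valleys S P"] by (simp add: power_add)
  qed simp
  also have "\<dots> = (-1) ^ (path_rank ?t - path_rank P) * int (card (small_chains (Suc k) P))"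
    by (simp add: card_small_chains_Suc sum_distrib_left)
  finally show ?case .
qed

text \<open>Filling raises each count by at most one, so the order could fail only at a valley of
  \<open>P\<close> where \<open>P\<close> and \<open>Q\<close> touch. There \<open>P \<le> Q\<close>
  forces the adjacent steps of \<open>Q\<close> to agree with those of \<open>P\<close>, so
  \<open>Q\<close> has a valley too and rises as well.\<close>

lemma filling_mono:
  assumes "P \<le> Q"
  shows "filling P \<le> filling Q"
proof -
  have len: "path_length Q = path_length P"
    and le: "\<And>i. i \<le> path_length P \<Longrightarrow> ups P i \<le> ups Q i"
    using assms by (auto simp: less_eq_binpath_ups)
  have "i \<in> valleys Q" if "i \<in> valleys P" "ups P i = ups Q i" for i
  proof -
    obtain j where j: "i = Suc j" "j < path_length P" "steps P ! j = Down"
      using \<open>i \<in> valleys P\<close> by (cases i) (auto simp: valleys_def)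
    then have "steps Q ! j = Down"
      using le[of j] that(2) len by (cases "steps Q ! j") (auto simp: ups_Suc)
    moreover have "steps Q ! i = Up" if "i < path_length P"
    proof -
      have "steps P ! i = Up"
        using \<open>i \<in> valleys P\<close> that by (simp add: valleys_def)
      then show ?thesis
        using le[of "Suc i"] \<open>ups P i = ups Q i\<close> that len by (cases "steps Q ! i") (auto simp: ups_Suc)
    qed
    ultimately show ?thesis
      using j len by (auto simp: valleys_def)
  qed
  then have "ups P i + (if i \<in> valleys P then 1 else 0) \<le> ups Q i + (if i \<in> valleys Q then 1 else 0)"
    if "i \<le> path_length P" for i
    using le[OF that] by (cases "ups P i = ups Q i") auto
  then show ?thesis
    using len by (simp add: filling_def less_eq_binpath_ups ups_turn_valleys)
qed

lemma turn_valleys_le_filling: "S \<subseteq> valleys P \<Longrightarrow> turn_valleys S P \<le> filling P"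
  by (auto simp: filling_def less_eq_binpath_ups ups_turn_valleys)

lemma path_length_funpow_filling [simp]: "path_length ((filling ^^ k) P) = path_length P"
  by (induction k) (simp_all add: filling_def)

lemma top_path_le_funpow_filling:
  "small_chains k P \<noteq> {} \<Longrightarrow> top_path (path_length P) \<le> (filling ^^ k) P"
proof (induction k arbitrary: P)
  case 0
  then show ?case
    by (simp add: small_chains_0 split: if_splits)
next
  case (Suc k)
  then obtain S where S: "S \<subseteq> valleys P" "small_chains k (turn_valleys S P) \<noteq> {}"
    by (auto simp: small_chains_Suc)
  \<comment> \<open>After one chain step the path lies below \<open>filling P\<close>, and
    monotonicity carries this bound through the remaining \<open>k\<close> fillings.\<close>
  have "mono (filling ^^ k)"
    by (intro mono_pow monoI filling_mono)
  then have "(filling ^^ k) (turn_valleys S P) \<le> (filling ^^ k) (filling P)"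
    using turn_valleys_le_filling[OF S(1)] by (rule monoD)
  then show ?case
    using Suc.IH[OF S(2)] by (simp add: funpow_swap1)
qed

lemma small_chains_empty:
  assumes "k < path_degree P"
  shows "small_chains k P = {}"
proof (rule ccontr)
  assume "small_chains k P \<noteq> {}"
  from top_path_le_funpow_filling[OF this] have "(filling ^^ k) P = top_path (path_length P)"
    using le_top_path[of "(filling ^^ k) P"] by (intro antisym) simp_all
  then have "path_degree P \<le> k"
    unfolding path_degree_def by (rule Least_le)
  with assms show False
    by simp
qed

theorem proposition6:
  fixes P :: binpath and k :: nat
  shows "(k < path_degree P \<longrightarrow>
            convolution_power moebius k P (top_path (path_length P)) = 0) \<and>
         (k = path_degree P \<longrightarrow>
            convolution_power moebius k P (top_path (path_length P)) =
              (-1) ^ interval_length P (top_path (path_length P)) * int (num_small_chains P))"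
proof -
  \<comment> \<open>Both cases are instances of the signed count valid for all \<open>k\<close>:
    below the degree there are no chains to count, and at the degree their number is
    \<open>num_small_chains\<close>.\<close>
  have "num_small_chains P = card (small_chains (path_degree P) P)"
    by (simp add: num_small_chains_def small_chains_def)
  then show ?thesis
    by (simp add: convolution_power_moebius_top small_chains_empty
        interval_length_binpath[OF le_top_path])
qed

end
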